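(* Let $\mathcal{A}$ be a complex unital structurable algebra of type $(2,1)$. Then $\mathcal{A}$ is isomorphic (as an algebra with involution) to the universal unital algebra ${\rm A}_1$ of type $(2,1)$, or to one of the following algebras with basis $\{e_1,e_2,e_3\}$, unit $e_1$, involution given by $\overline{e_1}=e_1$, $\overline{e_2}=e_2$, $\overline{e_3}=-e_3$, and multiplication table (besides $e_1e_i=e_ie_1=e_i$; all unlisted products of basis elements are zero): \begin{itemize} \item ${\rm A}_2$: $e_3e_3=e_2$; \item ${\rm A}_3$: $e_2e_2=e_2$; \item ${\rm A}_4$: $e_2e_2=e_2$, $e_3e_3=-e_1+e_2$; \item ${\rm A}_5$: $e_2e_3=e_2$, $e_3e_2=-e_2$, $e_3e_3=e_1$. \end{itemize}
   Context: An involution on an algebra $\mathcal{A}$ is a linear map $x\mapsto\overline{x}$ with $\overline{\overline{x}}=x$ and $\overline{xy}=\overline{y}\,\overline{x}$. For a unital algebra with involution write $\mathcal{A}=\mathcal{H}\oplus\mathcal{S}$ with $\mathcal{H}=\{a:\overline a=a\}$, $\mathcal{S}=\{a:\overline a=-a\}$; $\mathcal{A}$ is of type $(k,n-k)$ if $\dim\mathcal{A}=n$ and $\dim\mathcal{H}=k$. For $x,y\in\mathcal{A}$ define $V_{x,y}(z)=(x\overline{y})z+(z\overline{y})x-(z\overline{x})y$ and $T_x(z)=xz+zx-z\overline{x}$ (so $T_x=V_{x,1}$). A unital algebra with involution is structurable if $T_zV_{x,y}-V_{x,y}T_z=V_{T_z(x),y}-V_{x,T_{\overline z}(y)}$ for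 all $x,y,z$. An isomorphism of algebras with involution is a linear bijection $\varphi$ with $\varphi(xy)=\varphi(x)\varphi(y)$ and $\varphi(\overline x)=\overline{\varphi(x)}$. The universal unital algebra of type $(2,1)$ is the $3$-dimensional algebra with basis $e_1,e_2,e_3$, whose only nonzero products of basis elements are $e_1e_i=e_ie_1=e_i$, with involution $\overline{e_1}=e_1$, $\overline{e_2}=e_2$, $\overline{e_3}=-e_3$. *)

theory Defs
  imports "HOL-Analysis.Analysis"
begin

section \<open>Algebras with involution over the complex numbers (abstract carrier type)\<close>

text \<open>An algebra over the complex numbers is given by a type 'a with an additive group
structure, a complex scalar multiplication sc (forming a complex vector space), and a
bilinear product m. An involution is a linear map iv with iv (iv x) = x and
iv (m x y) = m (iv y) (iv x).\<close>

definition unital_alg_inv ::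
  "(complex \<Rightarrow> 'a::ab_group_add \<Rightarrow> 'a) \<Rightarrow> ('a \<Rightarrow> 'a \<Rightarrow> 'a) \<Rightarrow> ('a \<Rightarrow> 'a) \<Rightarrow> 'a \<Rightarrow> bool"
  where "unital_alg_inv sc m iv u \<longleftrightarrow>
     vector_space sc \<and>
     (\<forall>x. Vector_Spaces.linear sc sc (m x)) \<and>
     (\<forall>y. Vector_Spaces.linear sc sc (\<lambda>x. m x y)) \<and>
     (\<forall>x. m u x = x \<and> m x u = x) \<and>
     Vector_Spaces.linear sc sc iv \<and>
     (\<forall>x. iv (iv x) = x) \<and>
     (\<forall>x y. iv (m x y) = m (iv y) (iv x))"

text \<open>Type (k, n-k): dim A = n and dim H = k, H the hermitian (fixed) elements.\<close>

definition alg_type :: "(complex \<Rightarrow> 'a::ab_group_add \<Rightarrow> 'a) \<Rightarrow> ('a \<Rightarrow> 'a) \<Rightarrow> nat \<Rightarrow> nat \<Rightarrow> bool"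
  where "alg_type sc iv k l \<longleftrightarrow>
     vector_space.dim sc (UNIV :: 'a set) = k + l \<and>
     vector_space.dim sc {a. iv a = a} = k"

definition Vop :: "('a::ab_group_add \<Rightarrow> 'a \<Rightarrow> 'a) \<Rightarrow> ('a \<Rightarrow> 'a) \<Rightarrow> 'a \<Rightarrow> 'a \<Rightarrow> 'a \<Rightarrow> 'a"
  where "Vop m iv x y z = m (m x (iv y)) z + m (m z (iv y)) x - m (m z (iv x)) y"

definition Top :: "('a::ab_group_add \<Rightarrow> 'a \<Rightarrow> 'a) \<Rightarrow> ('a \<Rightarrow> 'a) \<Rightarrow> 'a \<Rightarrow> 'a \<Rightarrow> 'a"
  where "Top m iv x z = m x z + m z x - m z (iv x)"

definition structurable ::
  "(complex \<Rightarrow> 'a::ab_group_add \<Rightarrow> 'a) \<Rightarrow> ('a \<Rightarrow> 'a \<Rightarrow> 'a) \<Rightarrow> ('a \<Rightarrow> 'a) \<Rightarrow> 'a \<Rightarrow> bool"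
  where "structurable sc m iv u \<longleftrightarrow> unital_alg_inv sc m iv u \<and>
     (\<forall>x y z w.
        Top m iv z (Vop m iv x y w) - Vop m iv x y (Top m iv z w)
        = Vop m iv (Top m iv z x) y w - Vop m iv x (Top m iv (iv z) y) w)"

section \<open>The model algebras A1..A5 on complex^3 with basis e1, e2, e3\<close>

definition eb :: "3 \<Rightarrow> complex ^ 3" where "eb i = axis i 1"

text \<open>Products of basis elements e_i e_j in algebra A_k.\<close>
definition model_tbl :: "nat \<Rightarrow> 3 \<Rightarrow> 3 \<Rightarrow> complex ^ 3"
  where "model_tbl k i j =
    (if i = 1 then eb j
     else if j = 1 then eb i
     else if k = 2 then (if i = 3 \<and> j = 3 then eb 2 else 0)
     else if k = 3 then (if i = 2 \<and> j = 2 then eb 2 else 0)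
     else if k = 4 then (if i = 2 \<and> j = 2 then eb 2
                         else if i = 3 \<and> j = 3 then - eb 1 + eb 2 else 0)
     else if k = 5 then (if i = 2 \<and> j = 3 then eb 2
                         else if i = 3 \<and> j = 2 then - eb 2
                         else if i = 3 \<and> j = 3 then eb 1 else 0)
     else 0)"

definition model_mult :: "nat \<Rightarrow> complex ^ 3 \<Rightarrow> complex ^ 3 \<Rightarrow> complex ^ 3"
  where "model_mult k x y = (\<Sum>i\<in>UNIV. \<Sum>j\<in>UNIV. (x $ i * y $ j) *s model_tbl k i j)"

definition model_inv :: "complex ^ 3 \<Rightarrow> complex ^ 3"
  where "model_inv x = (\<chi> i. if i = 3 then - (x $ i) else x $ i)"

text \<open>Isomorphism of algebras with involution onto the model algebra A_k.\<close>
definition iso_to_model ::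
  "(complex \<Rightarrow> 'a::ab_group_add \<Rightarrow> 'a) \<Rightarrow> ('a \<Rightarrow> 'a \<Rightarrow> 'a) \<Rightarrow> ('a \<Rightarrow> 'a) \<Rightarrow> nat \<Rightarrow> ('a \<Rightarrow> complex ^ 3) \<Rightarrow> bool"
  where "iso_to_model sc m iv k \<phi> \<longleftrightarrow>
     Vector_Spaces.linear sc (*s) \<phi> \<and> bij \<phi> \<and>
     (\<forall>x y. \<phi> (m x y) = model_mult k (\<phi> x) (\<phi> y)) \<and>
     (\<forall>x. \<phi> (iv x) = model_inv (\<phi> x))"

end

theory Submission
  imports Defs
begin

(*
  Since the unit is hermitian and the hermitian part is 2-dimensional, the algebra has a basis
  1, h, s with h hermitian and s skew.  In these coordinates unitality and the involution force
  h h = a 1 + b h,  s s = c 1 + d h,  h s = p 1 + q h + r s,  s h = - p 1 - q h + r s.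
  The structurability identity at a few quadruples of basis vectors gives p = - q r, a = r^2 - b r,
  c = q^2 + d r - b d, d q = 0 and q (b - 2 r) = 0.  In each of the five resulting cases the basis
  1, (h - r 1) / l, s / n, for suitable l and n, has the multiplication table of one of A1, ..., A5;
  for A4 one needs n^2 = d (b - 2 r), which is where the field being complex is used.
*)

definition structurable_identity :: "('a::ab_group_add \<Rightarrow> 'a \<Rightarrow> 'a) \<Rightarrow> ('a \<Rightarrow> 'a) \<Rightarrow> bool"
  where "structurable_identity m iv \<longleftrightarrow>
    (\<forall>x y z w. Top m iv z (Vop m iv x y w) - Vop m iv x y (Top m iv z w)
       = Vop m iv (Top m iv z x) y w - Vop m iv x (Top m iv (iv z) y) w)"

lemma structurable_iff:
  "structurable sc m iv u \<longleftrightarrow> unital_alg_inv sc m iv u \<and> structurable_identity m iv"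
  unfolding structurable_def structurable_identity_def ..

lemma unital_alg_inv_pullback:
  fixes C :: "'b::ab_group_add \<Rightarrow> 'a::ab_group_add"
  assumes "Vector_Spaces.linear sc' sc C" and "inj C"
    and mult: "\<And>x y. C (m' x y) = m (C x) (C y)"
    and inv: "\<And>x. C (iv' x) = iv (C x)"
    and unit: "C u' = u"
    and "unital_alg_inv sc m iv u"
  shows "unital_alg_inv sc' m' iv' u'"
proof -
  interpret C: Vector_Spaces.linear sc' sc C by fact
  have eqI: "a = b" if "C a = C b" for a b
    using \<open>inj C\<close> that by (rule injD)
  have m_right: "m x (y + z) = m x y + m x z" "m x (sc c y) = sc c (m x y)"
    and m_left: "m (y + z) x = m y x + m z x" "m (sc c y) x = sc c (m y x)"
    and iv_lin: "iv (y + z) = iv y + iv z" "iv (sc c y) = sc c (iv y)"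
    and unital: "m u x = x" "m x u = x"
    and involutive: "iv (iv x) = x" "iv (m x y) = m (iv y) (iv x)" for x y z c
    using \<open>unital_alg_inv sc m iv u\<close>
    unfolding unital_alg_inv_def Vector_Spaces.linear_iff by auto
  note C_simps = mult inv unit C.add C.scale m_right m_left iv_lin unital involutive
  show ?thesis
    unfolding unital_alg_inv_def Vector_Spaces.linear_iff
    by (intro conjI allI C.vs1.vector_space_axioms; rule eqI; simp add: C_simps)
qed

lemma structurable_identity_pullback:
  fixes C :: "'b::ab_group_add \<Rightarrow> 'a::ab_group_add"
  assumes "Vector_Spaces.linear sc' sc C" and "inj C"
    and mult: "\<And>x y. C (m' x y) = m (C x) (C y)"
    and inv: "\<And>x. C (iv' x) = iv (C x)"
    and "structurable_identity m iv"
  shows "structurable_identity m' iv'"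
proof -
  interpret C: Vector_Spaces.linear sc' sc C by fact
  have Top: "C (Top m' iv' x z) = Top m iv (C x) (C z)" for x z
    by (simp add: Top_def C.add C.diff mult inv)
  have Vop: "C (Vop m' iv' x y z) = Vop m iv (C x) (C y) (C z)" for x y z
    by (simp add: Vop_def C.add C.diff mult inv)
  show ?thesis
    using \<open>structurable_identity m iv\<close>
    unfolding structurable_identity_def
    by (auto intro!: injD[OF \<open>inj C\<close>] simp: C.diff Top Vop inv)
qed

lemma structurable_pullback:
  fixes C :: "'b::ab_group_add \<Rightarrow> 'a::ab_group_add"
  assumes "Vector_Spaces.linear sc' sc C" and "inj C"
    and "\<And>x y. C (m' x y) = m (C x) (C y)"
    and "\<And>x. C (iv' x) = iv (C x)"
    and "C u' = u"
    and "structurable sc m iv u"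
  shows "structurable sc' m' iv' u'"
  using assms unital_alg_inv_pullback[of sc' sc C m' m iv' iv u' u]
    structurable_identity_pullback[of sc' sc C m' m iv' iv]
  unfolding structurable_iff by blast

lemma iso_to_model_comp_inv:
  fixes C :: "'b::ab_group_add \<Rightarrow> 'a::ab_group_add"
  assumes "Vector_Spaces.linear sc' sc C" and "bij C"
    and mult: "\<And>x y. C (m' x y) = m (C x) (C y)"
    and inv: "\<And>x. C (iv' x) = iv (C x)"
    and "iso_to_model sc' m' iv' k L"
  shows "iso_to_model sc m iv k (L \<circ> inv C)"
proof -
  interpret C: Vector_Spaces.linear sc' sc C by fact
  have C_inv: "C (inv C y) = y" for y
    using \<open>bij C\<close> by (simp add: bij_is_surj surj_f_inv_f)
  have inv_C: "inv C (C x) = x" for x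
    using \<open>bij C\<close> by (simp add: bij_is_inj)
  have "inv C (x + y) = inv C x + inv C y" "inv C (sc c x) = sc' c (inv C x)" for x y c
    by (metis C.add C_inv inv_C, metis C.scale C_inv inv_C)
  then have "Vector_Spaces.linear sc sc' (inv C)"
    by (simp add: Vector_Spaces.linear_iff C.vs1.vector_space_axioms C.vs2.vector_space_axioms)
  moreover have "inv C (m x y) = m' (inv C x) (inv C y)" for x y
    by (metis mult C_inv inv_C)
  moreover have "inv C (iv x) = iv' (inv C x)" for x
    by (metis inv C_inv inv_C)
  ultimately show ?thesis
    using \<open>iso_to_model sc' m' iv' k L\<close> \<open>bij C\<close>
    unfolding iso_to_model_def
    by (auto intro: Vector_Spaces.linear_compose bij_comp bij_imp_bij_inv)
qed

lemma unital_alg_inv_unit_hermitian: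
  assumes "unital_alg_inv sc m iv u"
  shows "iv u = u"
proof -
  have "m u (iv u) = iv u" "iv (iv u) = u" "iv (m u (iv u)) = m (iv (iv u)) (iv u)"
    using assms unfolding unital_alg_inv_def by blast+
  then show ?thesis by metis
qed

lemma (in vector_space) coordinates_linear_bij:
  assumes indep: "independent {a, b, c}" and card: "card {a, b, c} = 3"
    and span: "span {a, b, c} = UNIV"
  defines "C \<equiv> \<lambda>x :: 'a ^ 3. scale (x $ 1) a + scale (x $ 2) b + scale (x $ 3) c"
  shows "Vector_Spaces.linear vector_scalar_mult scale C" and "bij C"
proof -
  show lin: "Vector_Spaces.linear vector_scalar_mult scale C"
    unfolding Vector_Spaces.linear_iff C_def
    by (simp add: vec.vector_space_axioms vector_space_axioms algebra_simps)
  interpret C: Vector_Spaces.linear vector_scalar_mult scale C by (fact lin)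
  have distinct: "a \<noteq> b" "a \<noteq> c" "b \<noteq> c"
    using card by (auto simp: card_insert_if split: if_splits)
  have "inj C"
    unfolding C.inj_iff_eq_0
  proof (intro allI impI)
    fix x :: "'a ^ 3"
    assume "C x = 0"
    define coeff where "coeff v = (if v = a then x $ 1 else if v = b then x $ 2 else x $ 3)" for v
    have "(\<Sum>v\<in>{a, b, c}. scale (coeff v) v) = 0"
      using \<open>C x = 0\<close> distinct by (simp add: C_def coeff_def algebra_simps)
    then have "\<forall>v\<in>{a, b, c}. coeff v = 0"
      using independentD[OF indep, of "{a, b, c}" coeff] by auto
    then show "x = 0"
      using distinct by (simp add: coeff_def vec_eq_iff forall_3)
  qed
  moreover have "surj C"
  proof -
    have "{a, b, c} \<subseteq> range C"
      using image_eqI[of a C "axis 1 1"] image_eqI[of b C "axis 2 1"] image_eqI[of c C "axis 3 1"]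
      by (simp add: C_def axis_def)
    then have "span {a, b, c} \<subseteq> range C"
      using span_minimal C.subspace_image[OF vec.subspace_UNIV] by blast
    then show ?thesis using span by blast
  qed
  ultimately show "bij C" by (rule bijI)
qed

lemma (in vector_space) involution_adapted_basis:
  assumes "Vector_Spaces.linear scale scale iv" and involutive: "\<And>x. iv (iv x) = x"
    and char: "(2::'a) \<noteq> 0"
    and "iv u = u" and "u \<noteq> 0"
    and dim_UNIV: "dim (UNIV :: 'b set) = 3" and dim_fixed: "dim {x. iv x = x} = 2"
  obtains h s where "iv h = h" "iv s = - s"
    "independent {u, h, s}" "card {u, h, s} = 3" "span {u, h, s} = UNIV"
proof -
  interpret iv: Vector_Spaces.linear scale scale iv by fact
  define H where "H = {x. iv x = x}"
  have "subspace H"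
    unfolding H_def subspace_def by (simp add: iv.add iv.scale)
  obtain B where B: "{u} \<subseteq> B" "B \<subseteq> H" "independent B" "H \<subseteq> span B"
    using maximal_independent_subset_extend[of "{u}" H] \<open>iv u = u\<close> \<open>u \<noteq> 0\<close>
    by (auto simp: H_def)
  have "card B = 2"
    using basis_card_eq_dim[OF B(2,4,3)] dim_fixed by (simp add: H_def)
  then obtain h where h: "B = {u, h}" "h \<noteq> u"
    using B(1) by (auto simp: card_2_iff)
  obtain B3 where B3: "independent B3" "UNIV \<subseteq> span B3" "card B3 = 3"
    using basis_exists[of UNIV] dim_UNIV by metis
  interpret F: finite_dimensional_vector_space scale B3
    using B3 by unfold_locales (auto intro: card_ge_0_finite)
  have "H \<noteq> UNIV"
    using dim_fixed dim_UNIV by (auto simp: H_def)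
  then obtain x where "x \<notin> H" by blast
  define s where "s = x - iv x"
  have "iv s = - s"
    by (simp add: s_def iv.diff involutive)
  have "s \<notin> H"
  proof
    assume "s \<in> H"
    then have "- s = s"
      using \<open>iv s = - s\<close> by (simp add: H_def)
    then have "s + s = 0"
      by (metis add.right_inverse)
    moreover have "scale 2 s = s + s"
      using scale_left_distrib[of 1 1 s] by simp
    ultimately show False
      using char \<open>x \<notin> H\<close> by (simp add: s_def H_def)
  qed
  have "span {u, h} \<subseteq> H"
    using B(2) h(1) span_minimal \<open>subspace H\<close> by blast
  then have indep: "independent {u, h, s}"
    using independent_insertI[of s "{u, h}"] B(3) h(1) \<open>s \<notin> H\<close> by (auto simp: insert_commute)
  moreover have card: "card {u, h, s} = 3"
  proof -
    have "s \<notin> {u, h}"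
      using \<open>s \<notin> H\<close> B(2) h(1) by blast
    then show ?thesis
      using h(2) by (auto simp: card_insert_if)
  qed
  moreover have "span {u, h, s} = UNIV"
    using F.card_eq_dim[of "{u, h, s}" UNIV] indep card dim_UNIV by auto
  ultimately show ?thesis
    using that h B(2) \<open>iv s = - s\<close> by (auto simp: H_def)
qed

lemma eb_nth [simp]: "eb i $ j = (if j = i then 1 else 0)"
  by (simp add: eb_def axis_def)

lemma model_inv_nth: "model_inv x $ k = (if k = 3 then - x $ k else x $ k)"
  by (simp add: model_inv_def)

lemma type_21_coordinates:
  fixes sc :: "complex \<Rightarrow> 'a::ab_group_add \<Rightarrow> 'a"
  assumes "unital_alg_inv sc m iv u" and "alg_type sc iv 2 1"
  obtains C :: "complex ^ 3 \<Rightarrow> 'a"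
  where "Vector_Spaces.linear (*s) sc C" "bij C" "C (eb 1) = u" "\<And>x. C (model_inv x) = iv (C x)"
proof -
  interpret V: vector_space sc
    using assms(1) unfolding unital_alg_inv_def by blast
  have iv: "Vector_Spaces.linear sc sc iv" and involutive: "\<And>x. iv (iv x) = x"
    and unital: "\<And>x. m u x = x" and left: "\<And>y. Vector_Spaces.linear sc sc (\<lambda>x. m x y)"
    using assms(1) unfolding unital_alg_inv_def by blast+
  interpret iv: Vector_Spaces.linear sc sc iv by (fact iv)
  have "u \<noteq> 0"
  proof
    assume "u = 0"
    then have "x = 0" for x :: 'a
      using unital[of x] module_hom.zero[OF module_hom_linearI[OF left]] by simp
    then have "V.span {} = V.span UNIV" by auto
    then have "V.dim (UNIV :: 'a set) = 0"
      using V.dim_eq_card[OF _ V.independent_empty] by simp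
    then show False
      using assms(2) by (simp add: alg_type_def)
  qed
  then obtain h s where "iv h = h" "iv s = - s"
    and basis: "V.independent {u, h, s}" "card {u, h, s} = 3" "V.span {u, h, s} = UNIV"
    using V.involution_adapted_basis[OF iv involutive _ unital_alg_inv_unit_hermitian[OF assms(1)]] assms(2)
    by (auto simp: alg_type_def)
  define C where "C x = sc (x $ 1) u + sc (x $ 2) h + sc (x $ 3) s" for x :: "complex ^ 3"
  show thesis
  proof
    show "Vector_Spaces.linear (*s) sc C" "bij C"
      using V.coordinates_linear_bij[OF basis] unfolding C_def[abs_def] by auto
    show "C (eb 1) = u"
      by (simp add: C_def)
    show "C (model_inv x) = iv (C x)" for x
      using \<open>iv h = h\<close> \<open>iv s = - s\<close> unital_alg_inv_unit_hermitian[OF assms(1)]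
      by (simp add: C_def model_inv_nth iv.add iv.scale)
  qed
qed

definition table_mult :: "('n::finite \<Rightarrow> 'n \<Rightarrow> 'a::comm_ring_1 ^ 'n) \<Rightarrow> 'a ^ 'n \<Rightarrow> 'a ^ 'n \<Rightarrow> 'a ^ 'n"
  where "table_mult T x y = (\<Sum>i\<in>UNIV. \<Sum>j\<in>UNIV. (x $ i * y $ j) *s T i j)"

lemma model_mult_eq_table_mult: "model_mult k = table_mult (model_tbl k)"
  by (intro ext) (simp add: model_mult_def table_mult_def)

lemma table_mult_nth: "table_mult T x y $ k = (\<Sum>i\<in>UNIV. \<Sum>j\<in>UNIV. x $ i * y $ j * T i j $ k)"
  by (simp add: table_mult_def)

lemma table_mult_axis: "table_mult T (axis i 1) (axis j 1) = T i j"
proof -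
  have sum_if: "(\<Sum>j\<in>A. if P then f j else 0) = (if P then sum f A else 0)"
    for P and A :: "'n set" and f :: "'n \<Rightarrow> 'a"
    by simp
  show ?thesis
    by (simp add: vec_eq_iff table_mult_nth axis_def if_distrib[where f="\<lambda>x. x * _"] sum_if cong: if_cong)
qed

lemma table_mult_pullback:
  fixes C :: "'a::field ^ 'n::finite \<Rightarrow> 'b::ab_group_add"
  assumes "Vector_Spaces.linear (*s) sc C" and "surj C"
    and left: "\<And>y. Vector_Spaces.linear sc sc (\<lambda>x. m x y)"
    and right: "\<And>x. Vector_Spaces.linear sc sc (m x)"
  shows "C (table_mult (\<lambda>i j. inv C (m (C (axis i 1)) (C (axis j 1)))) x y) = m (C x) (C y)"
proof -
  interpret C: Vector_Spaces.linear "(*s)" sc C by fact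
  have m_sum_left: "m (sum g A) y = (\<Sum>a\<in>A. m (g a) y)"
    and m_scale_left: "m (sc c z) y = sc c (m z y)" for g :: "'n \<Rightarrow> 'b" and A y c z
    using module_hom.sum[OF module_hom_linearI[OF left]] module_hom.scale[OF module_hom_linearI[OF left]]
    by auto
  have m_sum_right: "m x (sum g A) = (\<Sum>a\<in>A. m x (g a))"
    and m_scale_right: "m x (sc c z) = sc c (m x z)" for g :: "'n \<Rightarrow> 'b" and A x c z
    using module_hom.sum[OF module_hom_linearI[OF right]] module_hom.scale[OF module_hom_linearI[OF right]]
    by auto
  have expand: "C v = (\<Sum>i\<in>UNIV. sc (v $ i) (C (axis i 1)))" for v
  proof -
    have "C v = C (\<Sum>i\<in>UNIV. v $ i *s axis i 1)"
      by (simp only: basis_expansion)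
    then show ?thesis
      by (simp add: C.sum C.scale)
  qed
  have "m (C x) (C y) = (\<Sum>i\<in>UNIV. \<Sum>j\<in>UNIV. sc (x $ i * y $ j) (m (C (axis i 1)) (C (axis j 1))))"
    by (subst expand[of x], subst expand[of y])
      (simp add: m_sum_left m_sum_right m_scale_left m_scale_right
        C.vs2.scale_sum_right, subst sum.swap, simp add: mult.commute)
  then show ?thesis
    unfolding table_mult_def by (simp add: C.sum C.scale surj_f_inv_f[OF \<open>surj C\<close>])
qed

lemma table_mult_neg:
  "table_mult T (- x) y = - table_mult T x y" "table_mult T x (- y) = - table_mult T x y"
  by (simp_all add: vec_eq_iff table_mult_nth sum_negf)

definition normal_table :: "complex \<Rightarrow> complex \<Rightarrow> complex \<Rightarrow> complex \<Rightarrow> complex \<Rightarrow> complex \<Rightarrow> complex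
    \<Rightarrow> 3 \<Rightarrow> 3 \<Rightarrow> complex ^ 3"
  where "normal_table a b c d p q r i j =
    (if i = 1 then eb j else if j = 1 then eb i
     else if i = 2 \<and> j = 2 then vector [a, b, 0]
     else if i = 2 \<and> j = 3 then vector [p, q, r]
     else if i = 3 \<and> j = 2 then vector [- p, - q, r]
     else vector [c, d, 0])"

lemma normal_table_nth: "normal_table a b c d p q r i j $ k =
    (if i = 1 then (if k = j then 1 else 0) else if j = 1 then (if k = i then 1 else 0)
     else if i = 2 \<and> j = 2 then (if k = 1 then a else if k = 2 then b else 0)
     else if i = 2 \<and> j = 3 then (if k = 1 then p else if k = 2 then q else r)
     else if i = 3 \<and> j = 2 then (if k = 1 then - p else if k = 2 then - q else r)
     else (if k = 1 then c else if k = 2 then d else 0))"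
  using exhaust_3[of k] by (auto simp: normal_table_def)

lemma normal_table_exists:
  assumes "unital_alg_inv (*s) (table_mult T) model_inv (eb 1)"
  shows "\<exists>a b c d p q r. T = normal_table a b c d p q r"
proof -
  have unit: "table_mult T (eb 1) x = x" "table_mult T x (eb 1) = x"
    and inv: "model_inv (table_mult T x y) = table_mult T (model_inv y) (model_inv x)" for x y
    using assms unfolding unital_alg_inv_def by auto
  have T: "T i j = table_mult T (eb i) (eb j)" for i j
    by (simp add: eb_def table_mult_axis)
  have inv_eb: "model_inv (eb 2) = eb 2" "model_inv (eb 3) = - eb 3"
    by (simp_all add: vec_eq_iff forall_3 model_inv_nth)
  have "model_inv (T 2 2) = T 2 2" "model_inv (T 3 3) = T 3 3" "model_inv (T 2 3) = - T 3 2"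
    using inv[of "eb 2" "eb 2"] inv[of "eb 3" "eb 3"] inv[of "eb 2" "eb 3"]
    by (simp_all add: T[symmetric] inv_eb table_mult_neg)
  then have "T 2 2 $ 3 = 0" "T 3 3 $ 3 = 0" "T 3 2 $ 1 = - T 2 3 $ 1" "T 3 2 $ 2 = - T 2 3 $ 2"
    "T 3 2 $ 3 = T 2 3 $ 3"
    by (simp_all add: vec_eq_iff forall_3 model_inv_nth)
  moreover have "T 1 j = eb j" "T i 1 = eb i" for i j
    using unit T by metis+
  ultimately have "T i j = normal_table (T 2 2 $ 1) (T 2 2 $ 2) (T 3 3 $ 1) (T 3 3 $ 2)
      (T 2 3 $ 1) (T 2 3 $ 2) (T 2 3 $ 3) i j" for i j
    using exhaust_3[of i] exhaust_3[of j] by (auto simp: vec_eq_iff forall_3 normal_table_nth)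
  then show ?thesis by blast
qed

lemma normal_table_structurable_equations:
  assumes "structurable_identity (table_mult (normal_table a b c d p q r)) model_inv"
  shows "p = - (q * r)" "a = r\<^sup>2 - b * r" "c = q\<^sup>2 + d * r - b * d" "d * q = 0" "q * (b - 2 * r) = 0"
proof -
  let ?M = "table_mult (normal_table a b c d p q r)"
  have identity: "(Top ?M model_inv z (Vop ?M model_inv x y w) - Vop ?M model_inv x y (Top ?M model_inv z w)) $ k
      = (Vop ?M model_inv (Top ?M model_inv z x) y w - Vop ?M model_inv x (Top ?M model_inv (model_inv z) y) w) $ k"
    for x y z w k
    using assms unfolding structurable_identity_def by metis
  note simps = Top_def Vop_def table_mult_nth normal_table_nth model_inv_nth sum_3 algebra_simps power2_eq_square
  have e1: "- 6 * q * r + 2 * p + 4 * b * q = 0"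
    using identity[where x="eb 1" and y="eb 3" and z="eb 2" and w="eb 2" and k=2] by (simp add: simps)
  have e2: "- 4 * r\<^sup>2 + 4 * b * r + 4 * a = 0"
    using identity[where x="eb 1" and y="eb 3" and z="eb 2" and w="eb 2" and k=3] by (simp add: simps)
  have e3: "2 * q\<^sup>2 + 2 * d * r - 2 * c - 2 * b * d = 0"
    using identity[where x="eb 1" and y="eb 3" and z="eb 2" and w="eb 3" and k=2] by (simp add: simps)
  have e4: "4 * q * r + 4 * p = 0"
    using identity[where x="eb 1" and y="eb 3" and z="eb 2" and w="eb 3" and k=3] by (simp add: simps)
  have e5: "8 * d * q = 0"
    using identity[where x="eb 3" and y="eb 3" and z="eb 3" and w="eb 1" and k=2] by (simp add: simps)
  show "p = - (q * r)" using e4 by algebra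
  show "a = r\<^sup>2 - b * r" using e2 by algebra
  show "c = q\<^sup>2 + d * r - b * d" using e3 by algebra
  show "d * q = 0" using e5 by simp
  show "q * (b - 2 * r) = 0" using e1 e4 by algebra
qed

(* Coordinates with respect to the basis e1, (e2 - r e1) / l, e3 / n. *)
definition basis_change :: "complex \<Rightarrow> complex \<Rightarrow> complex \<Rightarrow> complex ^ 3 \<Rightarrow> complex ^ 3"
  where "basis_change r l n x = vector [x $ 1 + r * x $ 2, l * x $ 2, n * x $ 3]"

lemma basis_change_nth:
  "basis_change r l n x $ k = (if k = 1 then x $ 1 + r * x $ 2 else if k = 2 then l * x $ 2 else n * x $ 3)"
  using exhaust_3[of k] by (auto simp: basis_change_def)

lemma model_tbl_nth: "model_tbl k i j $ l =
    (if i = 1 then (if l = j then 1 else 0)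
     else if j = 1 then (if l = i then 1 else 0)
     else if k = 2 then (if i = 3 \<and> j = 3 \<and> l = 2 then 1 else 0)
     else if k = 3 then (if i = 2 \<and> j = 2 \<and> l = 2 then 1 else 0)
     else if k = 4 then (if i = 2 \<and> j = 2 then (if l = 2 then 1 else 0)
                         else if i = 3 \<and> j = 3 then (if l = 1 then -1 else if l = 2 then 1 else 0) else 0)
     else if k = 5 then (if i = 2 \<and> j = 3 then (if l = 2 then 1 else 0)
                         else if i = 3 \<and> j = 2 then (if l = 2 then -1 else 0)
                         else if i = 3 \<and> j = 3 then (if l = 1 then 1 else 0) else 0)
     else 0)"
  by (simp add: model_tbl_def)

lemma basis_change_iso_to_model:
  assumes "l \<noteq> 0" and "n \<noteq> 0"
    and mult: "\<And>x y. basis_change r l n (table_mult T x y)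
      = model_mult k (basis_change r l n x) (basis_change r l n y)"
  shows "iso_to_model (*s) (table_mult T) model_inv k (basis_change r l n)"
  unfolding iso_to_model_def
proof (intro conjI allI mult)
  show "Vector_Spaces.linear (*s) (*s) (basis_change r l n)"
    unfolding Vector_Spaces.linear_iff
    by (auto simp: vec.vector_space_axioms vec_eq_iff forall_3 basis_change_nth algebra_simps)
  show "basis_change r l n (model_inv x) = model_inv (basis_change r l n x)" for x
    by (simp add: vec_eq_iff forall_3 basis_change_nth model_inv_nth)
  show "bij (basis_change r l n)"
  proof (rule bij_betw_byWitness)
    let ?inv = "\<lambda>y. vector [y $ 1 - r * y $ 2 / l, y $ 2 / l, y $ 3 / n] :: complex ^ 3"
    show "\<forall>x\<in>UNIV. ?inv (basis_change r l n x) = x" "\<forall>y\<in>UNIV. basis_change r l n (?inv y) = y"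
      using assms(1,2) by (simp_all add: vec_eq_iff forall_3 basis_change_nth)
  qed auto
qed

lemmas model_table_simps = basis_change_nth table_mult_nth normal_table_nth model_mult_eq_table_mult
  model_tbl_nth sum_3 algebra_simps power2_eq_square

lemma normal_table_iso_A1: "iso_to_model (*s) (table_mult (normal_table (- r\<^sup>2) (2 * r) 0 0 0 0 r)) model_inv 1
    (basis_change r 1 1)"
  by (rule basis_change_iso_to_model) (simp_all add: vec_eq_iff forall_3 model_table_simps)

lemma normal_table_iso_A2:
  assumes "d \<noteq> 0"
  shows "iso_to_model (*s) (table_mult (normal_table (- r\<^sup>2) (2 * r) (- (d * r)) d 0 0 r)) model_inv 2
    (basis_change r (1 / d) 1)"
proof (rule basis_change_iso_to_model)
  show "basis_change r (1 / d) 1 (table_mult (normal_table (- r\<^sup>2) (2 * r) (- (d * r)) d 0 0 r) x y)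
      = model_mult 2 (basis_change r (1 / d) 1 x) (basis_change r (1 / d) 1 y)" for x y
    unfolding vec_eq_iff forall_3 using assms by (simp add: model_table_simps; simp add: field_simps)
qed (use assms in simp_all)

lemma normal_table_iso_A3:
  assumes "b \<noteq> 2 * r"
  shows "iso_to_model (*s) (table_mult (normal_table (r\<^sup>2 - b * r) b 0 0 0 0 r)) model_inv 3
    (basis_change r (b - 2 * r) 1)"
  using assms by (intro basis_change_iso_to_model) (simp_all add: vec_eq_iff forall_3 model_table_simps)

lemma normal_table_iso_A4:
  assumes "b \<noteq> 2 * r" and "g \<noteq> 0" and "g * g = d * (b - 2 * r)"
  shows "iso_to_model (*s) (table_mult (normal_table (r\<^sup>2 - b * r) b (d * r - b * d) d 0 0 r)) model_inv 4
    (basis_change r (b - 2 * r) g)"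
proof (rule basis_change_iso_to_model)
  show "basis_change r (b - 2 * r) g (table_mult (normal_table (r\<^sup>2 - b * r) b (d * r - b * d) d 0 0 r) x y)
      = model_mult 4 (basis_change r (b - 2 * r) g x) (basis_change r (b - 2 * r) g y)" for x y
    unfolding vec_eq_iff forall_3
    by (simp add: model_table_simps; simp add: mult.assoc[symmetric] assms(3); simp add: algebra_simps)
qed (use assms in simp_all)

lemma normal_table_iso_A5:
  assumes "q \<noteq> 0"
  shows "iso_to_model (*s) (table_mult (normal_table (- r\<^sup>2) (2 * r) (q\<^sup>2) 0 (- (q * r)) q r)) model_inv 5
    (basis_change r 1 q)"
  using assms by (intro basis_change_iso_to_model) (simp_all add: vec_eq_iff forall_3 model_table_simps)

lemma normal_table_classification:
  assumes "p = - (q * r)" "a = r\<^sup>2 - b * r" "c = q\<^sup>2 + d * r - b * d"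
    and "d * q = 0" "q * (b - 2 * r) = 0"
  shows "\<exists>k\<in>{1, 2, 3, 4, 5 :: nat}. \<exists>L. iso_to_model (*s) (table_mult (normal_table a b c d p q r)) model_inv k L"
proof -
  consider (A1) "q = 0" "b = 2 * r" "d = 0" | (A2) "q = 0" "b = 2 * r" "d \<noteq> 0"
    | (A3) "q = 0" "b \<noteq> 2 * r" "d = 0" | (A4) "q = 0" "b \<noteq> 2 * r" "d \<noteq> 0"
    | (A5) "q \<noteq> 0" "b = 2 * r" "d = 0"
    using assms(4,5) by force
  then show ?thesis
  proof cases
    case A1
    then have "normal_table a b c d p q r = normal_table (- r\<^sup>2) (2 * r) 0 0 0 0 r"
      unfolding assms(1-3) by (simp add: power2_eq_square algebra_simps)
    then show ?thesis using normal_table_iso_A1 by fastforce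
  next
    case A2
    then have "normal_table a b c d p q r = normal_table (- r\<^sup>2) (2 * r) (- (d * r)) d 0 0 r"
      unfolding assms(1-3) by (simp add: power2_eq_square algebra_simps)
    then show ?thesis using normal_table_iso_A2[OF \<open>d \<noteq> 0\<close>] by fastforce
  next
    case A3
    then have "normal_table a b c d p q r = normal_table (r\<^sup>2 - b * r) b 0 0 0 0 r"
      unfolding assms(1-3) by (simp add: power2_eq_square algebra_simps)
    then show ?thesis using normal_table_iso_A3[OF \<open>b \<noteq> 2 * r\<close>] by fastforce
  next
    case A4
    define g where "g = csqrt (d * (b - 2 * r))"
    have g: "g * g = d * (b - 2 * r)"
      by (simp add: g_def flip: power2_eq_square)
    then have "g \<noteq> 0" using A4 by auto
    have "normal_table a b c d p q r = normal_table (r\<^sup>2 - b * r) b (d * r - b * d) d 0 0 r"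
      using A4 unfolding assms(1-3) by (simp add: power2_eq_square algebra_simps)
    then show ?thesis using normal_table_iso_A4[OF \<open>b \<noteq> 2 * r\<close> \<open>g \<noteq> 0\<close> g] by fastforce
  next
    case A5
    then have "normal_table a b c d p q r = normal_table (- r\<^sup>2) (2 * r) (q\<^sup>2) 0 (- (q * r)) q r"
      unfolding assms(1-3) by (simp add: power2_eq_square algebra_simps)
    then show ?thesis using normal_table_iso_A5[OF \<open>q \<noteq> 0\<close>] by fastforce
  qed
qed

lemma structurable_table_classification:
  fixes T :: "3 \<Rightarrow> 3 \<Rightarrow> complex ^ 3"
  assumes "structurable (*s) (table_mult T) model_inv (eb 1)"
  shows "\<exists>k\<in>{1, 2, 3, 4, 5 :: nat}. \<exists>L. iso_to_model (*s) (table_mult T) model_inv k L"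
proof -
  obtain a b c d p q r where T: "T = normal_table a b c d p q r"
    using assms normal_table_exists unfolding structurable_iff by blast
  then have "structurable_identity (table_mult (normal_table a b c d p q r)) model_inv"
    using assms unfolding structurable_iff by blast
  then show ?thesis
    unfolding T by (intro normal_table_classification normal_table_structurable_equations)
qed

theorem mainTheorem1:
  fixes sc :: "complex \<Rightarrow> 'a::ab_group_add \<Rightarrow> 'a"
    and m :: "'a \<Rightarrow> 'a \<Rightarrow> 'a" and iv :: "'a \<Rightarrow> 'a" and u :: 'a
  assumes "structurable sc m iv u"
    and "alg_type sc iv 2 1"
  shows "\<exists>k\<in>{1,2,3,4,5::nat}. \<exists>\<phi>. iso_to_model sc m iv k \<phi>"
proof -
  have unital: "unital_alg_inv sc m iv u"
    using assms(1) unfolding structurable_iff by blast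
  obtain C :: "complex ^ 3 \<Rightarrow> 'a" where C: "Vector_Spaces.linear (*s) sc C" "bij C"
    and unit: "C (eb 1) = u" and inv: "\<And>x. C (model_inv x) = iv (C x)"
    using type_21_coordinates[OF unital assms(2)] by blast
  define T where "T i j = inv C (m (C (eb i)) (C (eb j)))" for i j
  have mult: "C (table_mult T x y) = m (C x) (C y)" for x y
    using table_mult_pullback[OF C(1) bij_is_surj[OF C(2)]] unital
    unfolding T_def eb_def unital_alg_inv_def by blast
  have "structurable (*s) (table_mult T) model_inv (eb 1)"
    by (rule structurable_pullback[OF C(1) bij_is_inj[OF C(2)]]) (fact mult inv unit assms(1))+
  then obtain k L where k: "k \<in> {1, 2, 3, 4, 5}" and L: "iso_to_model (*s) (table_mult T) model_inv k L"
    using structurable_table_classification by blast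
  have "iso_to_model sc m iv k (L \<circ> inv C)"
    by (rule iso_to_model_comp_inv[OF C]) (fact mult inv L)+
  with k show ?thesis by blast
qed

end
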